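(* Let $W$ be an $N\times N$ matrix weight with monic matrix valued orthogonal polynomials $P(x,n)$ such that, for some constant matrix $A\in M_N(\mathbb{C})$ and some scalar polynomial $v(x)$ of degree $k$, $$\mathcal{D}=\partial_x+A\in\mathcal{F}_R(P)\qquad\text{and}\qquad \mathcal{D}^\dagger=-\mathcal{D}+v'(x),$$ where $\mathcal{D}^\dagger$ is the adjoint of $\mathcal{D}$ with respect to $W$. Then the coefficients $B(n),C(n)$ of the three-term recurrence relation $xP(x,n)=P(x,n+1)+B(n)P(x,n)+C(n)P(x,n-1)$ satisfy the discrete string relations $$[B(n),A]=I+\left(v'(L)\right)_{-1}(n)-\left(v'(L)\right)_{-1}(n+1),\qquad n\ge0,$$ $$[C(n),A]=C(n)\left(v'(L)\right)_{0}(n-1)-\left(v'(L)\right)_{0}(n)\,C(n),\qquad n\ge1.$$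
   Context: $W$ is a positive definite $M_N(\mathbb{C})$-valued weight function on a (possibly infinite) interval $[a,b]\subset\mathbb{R}$ with finite moments of all orders; $\langle H,G\rangle=\int_a^b H(y)W(y)G(y)^*\,dy$. The monic MVOPs $P(x,n)=x^nI+\cdots$ are the unique monic polynomials with $\langle P(\cdot,n),P(\cdot,m)\rangle=\mathcal{H}(n)\delta_{n,m}$, $\mathcal{H}(n)$ positive definite. Convention: $C(0):=0$. Differential operators with rational matrix coefficients act from the right: $F\cdot\sum_j\partial_x^jF_j(x)=\sum_jF^{(j)}(x)F_j(x)$. $\mathcal{D}^\dagger$ is the adjoint of $\mathcal{D}$ with respect to $W$ if $\langle F\cdot\mathcal{D},G\rangle=\langle F,G\cdot\mathcal{D}^\dagger\rangle$ for all matrix valued polynomials $F,G$. Difference operators $M=\sum_{j=-\ell}^mA_j(n)\delta^j$ act from the left by $(M\cdot P)(x,n)=\sum_jA_j(n)P(x,n+j)$ (sequences are $0$ at negative integers), and compose by $(A(n)\delta^i)(B(n)\delta^j)=A(n)B(n+i)\delta^{i+j}$. $\mathcal{F}_R(P)$ is the set of differential operators $\mathcal{D}$ with rational matrix coefficients for which there is a difference operator $M$ with $M\cdot P=P\cdot\mathcal{D}$. Let $L=\delta+B(n)+C(n)\delta^{-1}$. For a scalar polynomial $q$, $(q(L))_j(n)$ is the coefficient of $\delta^j$ in $q(L)=\sum_{j=-\deg q}^{\deg q}(q(L))_j(n)\,\delta^j$. $[X,Y]=XY-YX$. *)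

theory Defs
  imports
    "HOL-Analysis.Analysis"
    "HOL-Computational_Algebra.Computational_Algebra"
    "HOL-Computational_Algebra.Field_as_Ring"
begin

text \<open>Matrix-valued polynomials and rational functions are matrices with entries in
  \<open>\<complex>[x]\<close> and \<open>\<complex>(x)\<close>. On the types below \<open>**\<close> is the matrix product; the product \<open>*\<close> on
  vectors is componentwise and is not used.\<close>

type_synonym 'n cmat = "complex^'n^'n"
type_synonym 'n pmat = "complex poly^'n^'n"
type_synonym 'n rmat = "complex poly fract^'n^'n"

definition commutator :: "'n cmat \<Rightarrow> 'n cmat \<Rightarrow> 'n::finite cmat" where
  "commutator X Y = X ** Y - Y ** X"

definition ctranspose :: "'n cmat \<Rightarrow> 'n::finite cmat" where
  "ctranspose X = map_matrix cnj (transpose X)"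

definition positive_definite :: "'n::finite cmat \<Rightarrow> bool" where
  "positive_definite X \<longleftrightarrow> ctranspose X = X \<and>
     (\<forall>u. u \<noteq> 0 \<longrightarrow> 0 < Re (\<Sum>i\<in>UNIV. cnj (u $ i) * (X *v u) $ i))"

definition pmat_const :: "'n cmat \<Rightarrow> 'n::finite pmat" where
  "pmat_const X = map_matrix (\<lambda>c. [:c:]) X"

definition rmat_of_pmat :: "'n pmat \<Rightarrow> 'n::finite rmat" where
  "rmat_of_pmat F = map_matrix to_fract F"

definition rmat_const :: "'n cmat \<Rightarrow> 'n::finite rmat" where
  "rmat_const X = rmat_of_pmat (pmat_const X)"

definition pmat_coeff :: "'n pmat \<Rightarrow> nat \<Rightarrow> 'n::finite cmat" where
  "pmat_coeff F k = map_matrix (\<lambda>p. coeff p k) F"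

definition monic_pmat :: "nat \<Rightarrow> 'n::finite pmat \<Rightarrow> bool" where
  "monic_pmat n F \<longleftrightarrow> pmat_coeff F n = mat 1 \<and> (\<forall>k>n. pmat_coeff F k = 0)"

definition pmat_eval :: "'n pmat \<Rightarrow> real \<Rightarrow> 'n::finite cmat" where
  "pmat_eval F x = map_matrix (\<lambda>p. poly p (of_real x)) F"

text \<open>The value of a rational function is computed from its reduced representation; at a pole
  it is \<open>0\<close>, which concerns finitely many points only.\<close>

definition fract_eval :: "complex poly fract \<Rightarrow> complex \<Rightarrow> complex" where
  "fract_eval r z = poly (fst (quot_of_fract r)) z / poly (snd (quot_of_fract r)) z"

definition rmat_eval :: "'n rmat \<Rightarrow> real \<Rightarrow> 'n::finite cmat" where
  "rmat_eval F x = map_matrix (\<lambda>r. fract_eval r (of_real x)) F"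

text \<open>The interval has extended real endpoints. Endpoints are null sets, so \<open>einterval a b\<close>,
  which is the open interval, serves for \<open>[a, b]\<close>.\<close>

definition matrix_weight :: "ereal \<Rightarrow> ereal \<Rightarrow> (real \<Rightarrow> 'n::finite cmat) \<Rightarrow> bool" where
  "matrix_weight a b W \<longleftrightarrow> a < b \<and>
     (AE x in lborel. x \<in> einterval a b \<longrightarrow> positive_definite (W x)) \<and>
     (\<forall>k. set_integrable lborel (einterval a b) (\<lambda>x. x ^ k *\<^sub>R W x))"

definition weight_integrand ::
    "(real \<Rightarrow> 'n cmat) \<Rightarrow> (real \<Rightarrow> 'n cmat) \<Rightarrow> (real \<Rightarrow> 'n cmat) \<Rightarrow> real \<Rightarrow> 'n::finite cmat" where
  "weight_integrand W F G y = F y ** W y ** ctranspose (G y)"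

definition weight_inner ::
    "ereal \<Rightarrow> ereal \<Rightarrow> (real \<Rightarrow> 'n cmat) \<Rightarrow> (real \<Rightarrow> 'n cmat) \<Rightarrow> (real \<Rightarrow> 'n cmat) \<Rightarrow> 'n::finite cmat" where
  "weight_inner a b W F G = (LINT y:einterval a b|lborel. weight_integrand W F G y)"

definition monic_mvops ::
    "ereal \<Rightarrow> ereal \<Rightarrow> (real \<Rightarrow> 'n cmat) \<Rightarrow> (nat \<Rightarrow> 'n::finite pmat) \<Rightarrow> bool" where
  "monic_mvops a b W P \<longleftrightarrow> (\<forall>n. monic_pmat n (P n)) \<and>
     (\<exists>H. (\<forall>n. positive_definite (H n)) \<and>
       (\<forall>n m. weight_inner a b W (pmat_eval (P n)) (pmat_eval (P m)) = (if n = m then H n else 0)))"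

text \<open>A differential operator \<open>\<Sum>j. \<partial>\<^sub>x\<^sup>j F\<^sub>j(x)\<close> is its finite coefficient sequence, stored
  as a polynomial in \<open>\<partial>\<^sub>x\<close>. Only the additive structure of this polynomial type is meaningful:
  its product is not the composition of operators.\<close>

type_synonym 'n diffop = "'n rmat poly"

definition diffop_act :: "'n pmat \<Rightarrow> 'n diffop \<Rightarrow> 'n::finite rmat" where
  "diffop_act F D =
     (\<Sum>j\<le>degree D. rmat_of_pmat (map_matrix (pderiv ^^ j) F) ** coeff D j)"

definition is_adjoint ::
    "ereal \<Rightarrow> ereal \<Rightarrow> (real \<Rightarrow> 'n cmat) \<Rightarrow> 'n diffop \<Rightarrow> 'n::finite diffop \<Rightarrow> bool" where
  "is_adjoint a b W D D' \<longleftrightarrow> (\<forall>F G.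
     set_integrable lborel (einterval a b)
       (weight_integrand W (rmat_eval (diffop_act F D)) (pmat_eval G)) \<and>
     set_integrable lborel (einterval a b)
       (weight_integrand W (pmat_eval F) (rmat_eval (diffop_act G D'))) \<and>
     weight_inner a b W (rmat_eval (diffop_act F D)) (pmat_eval G) =
     weight_inner a b W (pmat_eval F) (rmat_eval (diffop_act G D')))"

text \<open>Sequences are indexed by the natural numbers and are \<open>0\<close> at negative integers.\<close>

definition seq_at :: "(nat \<Rightarrow> 'a::zero) \<Rightarrow> int \<Rightarrow> 'a" where
  "seq_at s k = (if k < 0 then 0 else s (nat k))"

text \<open>\<open>M j n\<close> is the coefficient \<open>A\<^sub>j(n)\<close> of \<open>\<delta>\<^sup>j\<close> in a difference operator \<open>M\<close>.\<close>

type_synonym 'n shiftop = "int \<Rightarrow> nat \<Rightarrow> 'n cmat"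

definition shiftop_support :: "'n::finite shiftop \<Rightarrow> int set" where
  "shiftop_support M = {j. \<exists>n. M j n \<noteq> 0}"

definition is_shiftop :: "'n::finite shiftop \<Rightarrow> bool" where
  "is_shiftop M \<longleftrightarrow> finite (shiftop_support M)"

definition shiftop_act :: "'n shiftop \<Rightarrow> (nat \<Rightarrow> 'n pmat) \<Rightarrow> nat \<Rightarrow> 'n::finite pmat" where
  "shiftop_act M P n =
     (\<Sum>j\<in>shiftop_support M. pmat_const (M j n) ** seq_at P (int n + j))"

definition shiftop_comp :: "'n shiftop \<Rightarrow> 'n shiftop \<Rightarrow> 'n::finite shiftop" where
  "shiftop_comp M K j n =
     (\<Sum>i\<in>shiftop_support M. M i n ** seq_at (K (j - i)) (int n + i))"

definition shiftop_id :: "'n::finite shiftop" where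
  "shiftop_id j n = (if j = 0 then mat 1 else 0)"

definition shiftop_power :: "'n shiftop \<Rightarrow> nat \<Rightarrow> 'n::finite shiftop" where
  "shiftop_power M r = (shiftop_comp M ^^ r) shiftop_id"

definition shiftop_poly :: "complex poly \<Rightarrow> 'n shiftop \<Rightarrow> 'n::finite shiftop" where
  "shiftop_poly q M j n = (\<Sum>r\<le>degree q. mat (coeff q r) ** shiftop_power M r j n)"

definition fourier_right :: "(nat \<Rightarrow> 'n pmat) \<Rightarrow> 'n::finite diffop set" where
  "fourier_right P =
     {D. \<exists>M. is_shiftop M \<and> (\<forall>n. rmat_of_pmat (shiftop_act M P n) = diffop_act (P n) D)}"

definition jacobi_op :: "(nat \<Rightarrow> 'n cmat) \<Rightarrow> (nat \<Rightarrow> 'n cmat) \<Rightarrow> 'n::finite shiftop" where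
  "jacobi_op B C j n =
     (if j = 1 then mat 1 else if j = 0 then B n else if j = -1 then C n else 0)"

definition three_term_recurrence ::
    "(nat \<Rightarrow> 'n pmat) \<Rightarrow> (nat \<Rightarrow> 'n cmat) \<Rightarrow> (nat \<Rightarrow> 'n::finite cmat) \<Rightarrow> bool" where
  "three_term_recurrence P B C \<longleftrightarrow> C 0 = 0 \<and>
     (\<forall>n. mat [:0, 1:] ** P n =
       P (n + 1) + pmat_const (B n) ** P n + pmat_const (C n) ** seq_at P (int n - 1))"

end

theory Submission
  imports Defs
begin

text \<open>
  Write \<open>\<nabla>F = F' + F A\<close> for the right action of \<open>\<partial>\<^sub>x + A\<close>, \<open>q = v'\<close>, \<open>H(n)\<close> for the squared norm of
  \<open>P(x,n)\<close>, and \<open>V\<^sub>j(n)\<close> for the coefficients of \<open>q(L)\<close>. The weight enters only through the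
  matrix-valued pairing \<open>\<langle>F, G\<rangle>\<close> of polynomials, which is sesquilinear over constant matrices,
  Hermitian, and for which multiplication by \<open>x\<close> is symmetric.

  The assumption on the adjoint of \<open>\<partial>\<^sub>x + A\<close> is the integration by parts rule
  \<open>\<langle>\<nabla>F, G\<rangle> + \<langle>F, \<nabla>G\<rangle> = \<langle>F, q G\<rangle>\<close>. Its left side is Hermitian in \<open>F\<close> and \<open>G\<close>, hence so is its
  right side: multiplication by \<open>q\<close> is symmetric, although the coefficients of \<open>q\<close> are only
  supposed to be complex (lemma \<open>potential_symmetric\<close>). So the rule may be read with
  \<open>\<langle>q F, G\<rangle>\<close> on the right.

  By the recurrence, \<open>q P(n)\<close> is \<open>q(L)\<close> applied to \<open>P\<close>, which gives
  \<open>\<langle>q P(n), P(m)\<rangle> = V\<^sub>m\<^sub>-\<^sub>n(n) H(m)\<close> (lemma \<open>pairing_potential\<close>). On the other hand \<open>\<nabla>P(n)\<close> has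
  degree at most \<open>n\<close> and its coefficient at \<open>x\<^sup>n\<close> is \<open>A\<close>. Integration by parts for \<open>P(n)\<close> with
  itself and with \<open>P(n-1)\<close> therefore yields the two identities behind the string relations:
  \<open>V\<^sub>0(n) H(n) = A H(n) + H(n) A\<^sup>*\<close> (lemma \<open>V_diag\<close>) and
  \<open>\<langle>\<nabla>P(n), P(n-1)\<rangle> = V\<^sub>-\<^sub>1(n) H(n-1)\<close> (lemma \<open>pairing_nabla_sub\<close>).

  The relation for \<open>C\<close> follows from the first identity by eliminating \<open>A\<^sup>*\<close> between the indices
  \<open>n-1\<close> and \<open>n\<close>, using \<open>C(n) H(n-1) = H(n)\<close>. The relation for \<open>B\<close> is the canonical commutation
  relation: \<open>\<nabla>(x P(n)) = x \<nabla>P(n) + P(n)\<close>, paired with \<open>P(n)\<close>. Expanding \<open>x P(n)\<close> inside \<open>\<nabla>\<close> on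
  the left, and moving \<open>x\<close> to the second argument on the right, expresses both sides through the
  second identity and \<open>\<langle>\<nabla>P(n), P(n)\<rangle> = A H(n)\<close>. In both cases the invertible factor \<open>H\<close> is cancelled at the end.
\<close>

section \<open>Algebra of square matrices\<close>

lemma matrix_mult_diff_left: "(X - Y) ** Z = X ** Z - Y ** (Z :: 'a::ring_1^'n::finite^'n)"
  by (simp add: vec_eq_iff matrix_matrix_mult_def left_diff_distrib sum_subtractf)

lemma matrix_mult_diff_right: "Z ** (X - Y) = Z ** X - Z ** (Y :: 'a::ring_1^'n::finite^'n)"
  by (simp add: vec_eq_iff matrix_matrix_mult_def right_diff_distrib sum_subtractf)

lemma matrix_mult_uminus_right: "Z ** (- X) = - (Z ** (X :: 'a::ring_1^'n::finite^'n))"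
  by (simp add: vec_eq_iff matrix_matrix_mult_def sum_negf)

lemma matrix_mult_add_left: "(X + Y) ** Z = X ** Z + Y ** (Z :: 'a::semiring_1^'n::finite^'n)"
  by (simp add: vec_eq_iff matrix_matrix_mult_def distrib_right sum.distrib)

lemma matrix_mult_zero_left: "0 ** Z = (0 :: 'a::semiring_1^'n::finite^'n)"
  by (simp add: vec_eq_iff matrix_matrix_mult_def)

lemma matrix_mult_zero_right: "Z ** 0 = (0 :: 'a::semiring_1^'n::finite^'n)"
  by (simp add: vec_eq_iff matrix_matrix_mult_def)

lemma matrix_mult_sum_left: "sum f S ** Z = (\<Sum>s\<in>S. f s ** (Z :: 'a::semiring_1^'n::finite^'n))"
  by (induction S rule: infinite_finite_induct)
     (auto simp: matrix_mult_add_left matrix_mult_zero_left)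

lemma matrix_mult_sum_right: "Z ** sum f S = (\<Sum>s\<in>S. Z ** (f s :: 'a::semiring_1^'n::finite^'n))"
  by (induction S rule: infinite_finite_induct)
     (auto simp: matrix_add_ldistrib matrix_mult_zero_right)

lemma mat_mult_eq_scale: "mat q ** F = map_matrix ((*) q) (F :: 'a::semiring_1^'n::finite^'n)"
  by (simp add: vec_eq_iff matrix_matrix_mult_def mat_def if_distrib[of "\<lambda>z. z * _"]
      cong: if_cong)

lemma mult_mat_eq_scale: "F ** mat q = map_matrix ((*) q) (F :: 'a::comm_semiring_1^'n::finite^'n)"
  by (simp add: vec_eq_iff matrix_matrix_mult_def mat_def if_distrib[of "\<lambda>z. _ * z"] mult.commute
      cong: if_cong)

lemma mat_mult_commute: "mat q ** F = F ** mat q"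
  for F :: "'a::comm_semiring_1^'n::finite^'n"
  by (simp add: mat_mult_eq_scale mult_mat_eq_scale)

lemmas matrix_algebra_simps =
  matrix_mult_diff_left matrix_mult_diff_right matrix_mult_add_left matrix_add_ldistrib
  matrix_mult_zero_left matrix_mult_zero_right matrix_mul_assoc

section \<open>Conjugate transpose and positive definiteness\<close>

lemma ctranspose_nth: "ctranspose X $ i $ j = cnj (X $ j $ i)"
  by (simp add: ctranspose_def transpose_def)

lemma ctranspose_ctranspose: "ctranspose (ctranspose X) = X"
  by (simp add: vec_eq_iff ctranspose_nth)

lemma ctranspose_mult: "ctranspose (X ** Y) = ctranspose Y ** ctranspose X"
  by (simp add: vec_eq_iff ctranspose_nth matrix_matrix_mult_def mult.commute)

lemma ctranspose_add: "ctranspose (X + Y) = ctranspose X + ctranspose Y"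
  by (simp add: vec_eq_iff ctranspose_nth)

lemma ctranspose_scaleR: "ctranspose (r *\<^sub>R X) = r *\<^sub>R ctranspose X"
  by (simp add: vec_eq_iff ctranspose_nth)

lemma ctranspose_zero: "ctranspose 0 = 0"
  by (simp add: vec_eq_iff ctranspose_nth)

lemma ctranspose_sum: "ctranspose (sum f S) = (\<Sum>s\<in>S. ctranspose (f s))"
  by (induction S rule: infinite_finite_induct) (auto simp: ctranspose_add ctranspose_zero)

lemma ctranspose_mat: "ctranspose (mat c) = mat (cnj c)"
  by (simp add: vec_eq_iff ctranspose_nth mat_def)

lemma bounded_linear_ctranspose: "bounded_linear (ctranspose :: 'n::finite cmat \<Rightarrow> 'n cmat)"
  unfolding linear_conv_bounded_linear[symmetric]
  by (intro linearI ctranspose_add ctranspose_scaleR)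

text \<open>Bounded linearity is what allows constant matrix factors to pass through the
  Bochner integral.\<close>

lemma bounded_linear_mult_left: "bounded_linear (\<lambda>X. (L :: 'n::finite cmat) ** X)"
  unfolding linear_conv_bounded_linear[symmetric]
  by (intro linearI)
     (simp_all add: vec_eq_iff matrix_matrix_mult_def scaleR_sum_right distrib_left sum.distrib)

lemma bounded_linear_mult_right: "bounded_linear (\<lambda>X. X ** (R :: 'n::finite cmat))"
  unfolding linear_conv_bounded_linear[symmetric]
  by (intro linearI)
     (simp_all add: vec_eq_iff matrix_matrix_mult_def scaleR_sum_right distrib_right sum.distrib)

lemma positive_definite_right_cancel:
  assumes "positive_definite H" and "X ** H = Y ** H"
  shows "X = Y"
proof -
  have "u = 0" if "H *v u = 0" for u
    using assms(1) that unfolding positive_definite_def by fastforce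
  then obtain K where "K ** H = mat 1"
    using matrix_left_invertible_ker[of H] by blast
  then have "H ** K = mat 1"
    by (simp add: matrix_left_right_inverse)
  then show ?thesis
    using assms(2) by (metis matrix_mul_assoc matrix_mul_rid)
qed

section \<open>Matrix polynomials and rational matrix functions\<close>

lemma pmat_coeff_add: "pmat_coeff (F + G) k = pmat_coeff F k + pmat_coeff G k"
  by (simp add: vec_eq_iff pmat_coeff_def)

lemma pmat_coeff_diff: "pmat_coeff (F - G) k = pmat_coeff F k - pmat_coeff G k"
  by (simp add: vec_eq_iff pmat_coeff_def)

lemma pmat_coeff_const_mult: "pmat_coeff (pmat_const X ** F) k = X ** pmat_coeff F k"
  by (simp add: vec_eq_iff pmat_coeff_def pmat_const_def matrix_matrix_mult_def coeff_sum)

lemma pmat_coeff_mult_const: "pmat_coeff (F ** pmat_const X) k = pmat_coeff F k ** X"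
proof -
  have "coeff (p * [:c:]) k = coeff p k * c" for p :: "complex poly" and c
    by (simp add: mult.commute[of p] mult.commute[of c])
  then show ?thesis
    by (simp del: mult_pCons_right add: vec_eq_iff pmat_coeff_def pmat_const_def matrix_matrix_mult_def coeff_sum)
qed

lemma pmat_eqI:
  assumes "\<And>k. pmat_coeff F k = pmat_coeff G k"
  shows "F = G"
  using assms by (simp add: vec_eq_iff pmat_coeff_def poly_eq_iff)

lemma pmat_eval_add: "pmat_eval (F + G) y = pmat_eval F y + pmat_eval G y"
  by (simp add: vec_eq_iff pmat_eval_def)

lemma pmat_eval_mult: "pmat_eval (F ** G) y = pmat_eval F y ** pmat_eval G y"
  by (simp add: vec_eq_iff pmat_eval_def matrix_matrix_mult_def poly_sum)

lemma pmat_eval_const: "pmat_eval (pmat_const X) y = X"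
  by (simp add: vec_eq_iff pmat_eval_def pmat_const_def)

lemma pmat_eval_mat: "pmat_eval (mat q) y = mat (poly q (of_real y))"
  by (simp add: vec_eq_iff pmat_eval_def mat_def)

text \<open>One bound \<open>d\<close> for the degrees of all entries makes a matrix polynomial a finite
  combination of powers, so that integrals of polynomials reduce to the moments of the weight.\<close>

lemma pmat_eval_expansion:
  obtains d where "\<And>y. pmat_eval F y = (\<Sum>j\<le>d. y ^ j *\<^sub>R pmat_coeff F j)"
proof
  define d where "d = (\<Sum>i\<in>UNIV. \<Sum>j\<in>UNIV. degree (F $ i $ j))"
  have deg: "degree (F $ i $ j) \<le> d" for i j
    unfolding d_def
    by (rule order_trans[OF member_le_sum[of j UNIV "\<lambda>j. degree (F $ i $ j)"]
          member_le_sum[of i UNIV "\<lambda>i. \<Sum>j\<in>UNIV. degree (F $ i $ j)"]]) auto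
  have "poly (F $ i $ j) z = (\<Sum>k\<le>d. z ^ k * coeff (F $ i $ j) k)" for i j z
  proof -
    have "poly (F $ i $ j) z = (\<Sum>k\<le>degree (F $ i $ j). z ^ k * coeff (F $ i $ j) k)"
      by (simp add: poly_altdef mult.commute)
    also have "\<dots> = (\<Sum>k\<le>d. z ^ k * coeff (F $ i $ j) k)"
      using deg[of i j] by (intro sum.mono_neutral_left) (auto simp: coeff_eq_0)
    finally show ?thesis .
  qed
  then show "pmat_eval F y = (\<Sum>j\<le>d. y ^ j *\<^sub>R pmat_coeff F j)" for y
    by (simp add: vec_eq_iff pmat_eval_def pmat_coeff_def
        scaleR_conv_of_real[where 'a = complex])
qed

lemma rmat_of_pmat_add: "rmat_of_pmat (F + G) = rmat_of_pmat F + rmat_of_pmat G"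
  by (simp add: vec_eq_iff rmat_of_pmat_def)

lemma rmat_of_pmat_diff: "rmat_of_pmat (F - G) = rmat_of_pmat F - rmat_of_pmat G"
  by (simp add: vec_eq_iff rmat_of_pmat_def)

lemma rmat_of_pmat_mult: "rmat_of_pmat (F ** G) = rmat_of_pmat F ** rmat_of_pmat G"
  by (simp add: vec_eq_iff rmat_of_pmat_def matrix_matrix_mult_def)

lemma rmat_of_pmat_mat: "rmat_of_pmat (mat q) = mat (to_fract q)"
  by (simp add: vec_eq_iff rmat_of_pmat_def mat_def)

lemma rmat_eval_of_pmat: "rmat_eval (rmat_of_pmat F) = pmat_eval F"
  by (rule ext) (simp add: vec_eq_iff rmat_eval_def rmat_of_pmat_def pmat_eval_def fract_eval_def)

section \<open>The first-order operator\<close>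

text \<open>The right action of \<open>\<partial>\<^sub>x + A\<close> on matrix polynomials. It maps polynomials to
  polynomials, so that rational matrix functions are only needed to connect it with the general
  notion of a differential operator.\<close>

definition nabla :: "'n cmat \<Rightarrow> 'n pmat \<Rightarrow> 'n::finite pmat" where
  "nabla A F = map_matrix pderiv F + F ** pmat_const A"

lemma nabla_add: "nabla A (F + G) = nabla A F + nabla A G"
  unfolding nabla_def by (simp add: vec_eq_iff pderiv_add matrix_mult_add_left)

text \<open>Operators that act from the right commute with constant matrices on the left.\<close>

lemma nabla_const_mult:
  fixes F :: "'n::finite pmat"
  shows "nabla A (pmat_const X ** F) = pmat_const X ** nabla A F"
proof -
  have 1: "pderiv ([:c:] * p) = [:c:] * pderiv p" for c and p :: "complex poly"
    by (simp add: pderiv_smult)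
  have "map_matrix pderiv (pmat_const X ** F) = pmat_const X ** map_matrix pderiv F"
    by (simp only: vec_eq_iff matrix_matrix_mult_def pmat_const_def nth_map_matrix vec_lambda_beta
        higher_pderiv_sum[where n = 1, simplified] 1 simp_thms)
  then show ?thesis
    by (simp add: nabla_def matrix_algebra_simps)
qed

text \<open>The canonical commutation relation: the extra term \<open>F\<close> is the source of the
  identity matrix in the string relation for \<open>B\<close>.\<close>

lemma nabla_x_mult: "nabla A (mat [:0, 1:] ** F) = mat [:0, 1:] ** nabla A F + F"
proof -
  have "map_matrix pderiv (mat [:0, 1:] ** F) = F + mat [:0, 1:] ** map_matrix pderiv F"
    by (simp add: vec_eq_iff mat_mult_eq_scale pderiv_mult pderiv_pCons)
  then show ?thesis
    by (simp add: nabla_def matrix_algebra_simps)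
qed

lemma nabla_coeff: 
  "pmat_coeff (nabla A F) k = real (Suc k) *\<^sub>R pmat_coeff F (Suc k) + pmat_coeff F k ** A"
  by (simp add: nabla_def pmat_coeff_add pmat_coeff_mult_const)
     (simp add: vec_eq_iff pmat_coeff_def coeff_pderiv
      scaleR_conv_of_real[where 'a = complex])

text \<open>Also valid for \<open>Y = 0\<close>, when the list of coefficients is shorter and the sum that
  defines the action stops at the term of order zero.\<close>

lemma diffop_act_order_one:
  fixes F :: "'n::finite pmat"
  shows "diffop_act F [:X, Y:] = rmat_of_pmat F ** X + rmat_of_pmat (map_matrix pderiv F) ** Y"
proof -
  have "map_matrix (\<lambda>p. p) F = F"
    by (simp add: vec_eq_iff)
  moreover have "pderiv \<circ> (\<lambda>p. p) = (pderiv :: complex poly \<Rightarrow> _)"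
    by (simp add: comp_def)
  ultimately show ?thesis
    by (cases "Y = 0") (simp_all add: diffop_act_def matrix_mult_zero_right id_def)
qed

lemma diffop_act_nabla:
  "diffop_act F [:rmat_const A, mat 1:] = rmat_of_pmat (nabla A F)"
  by (simp add: diffop_act_order_one nabla_def rmat_of_pmat_add rmat_of_pmat_mult rmat_const_def)

lemma diffop_act_nabla_adjoint:
  "diffop_act F (- [:rmat_const A, mat 1:] + [:mat (to_fract q):])
   = rmat_of_pmat (mat q ** F - nabla A F)"
proof -
  have "- [:rmat_const A, mat 1:] + [:mat (to_fract q):]
      = [:mat (to_fract q) - rmat_const A, - mat 1:]"
    by simp
  then show ?thesis
    by (simp only: diffop_act_order_one nabla_def rmat_of_pmat_add rmat_of_pmat_diff
        rmat_of_pmat_mult rmat_const_def rmat_of_pmat_mat mat_mult_commute[of _ "rmat_of_pmat F"]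
        matrix_mult_diff_right matrix_mult_uminus_right matrix_mul_rid) simp
qed

section \<open>The matrix-valued pairing\<close>

locale weighted_interval =
  fixes a b :: ereal and W :: "real \<Rightarrow> 'n::finite cmat"
  assumes weight: "matrix_weight a b W"
begin

definition pairing :: "'n pmat \<Rightarrow> 'n pmat \<Rightarrow> 'n cmat" where
  "pairing F G = weight_inner a b W (pmat_eval F) (pmat_eval G)"

text \<open>Expanding both polynomials leaves finitely many moments of \<open>W\<close>, each between
  constant matrices.\<close>

lemma integrable_pairing:
  "set_integrable lborel (einterval a b) (weight_integrand W (pmat_eval F) (pmat_eval G))"
proof -
  obtain d where F: "\<And>y. pmat_eval F y = (\<Sum>j\<le>d. y ^ j *\<^sub>R pmat_coeff F j)"
    using pmat_eval_expansion by blast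
  obtain e where G: "\<And>y. pmat_eval G y = (\<Sum>j\<le>e. y ^ j *\<^sub>R pmat_coeff G j)"
    using pmat_eval_expansion by blast
  have scale: "(r *\<^sub>R X) ** Y ** (s *\<^sub>R Z) = X ** ((r * s) *\<^sub>R Y) ** Z"
    for r s and X Y Z :: "'n cmat"
    by (simp add: linear_scale[OF bounded_linear.linear[OF bounded_linear_mult_left]]
        linear_scale[OF bounded_linear.linear[OF bounded_linear_mult_right]])
  have "weight_integrand W (pmat_eval F) (pmat_eval G) = (\<lambda>y. \<Sum>k\<le>e. \<Sum>j\<le>d.
      pmat_coeff F j ** (y ^ (j + k) *\<^sub>R W y) ** ctranspose (pmat_coeff G k))"
    by (rule ext) (simp add: weight_integrand_def F G matrix_mult_sum_left matrix_mult_sum_right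
        ctranspose_sum ctranspose_scaleR scale power_add)
  moreover have "set_integrable lborel (einterval a b)
      (\<lambda>y. pmat_coeff F j ** (y ^ (j + k) *\<^sub>R W y) ** ctranspose (pmat_coeff G k))" for j k
  proof -
    have "set_integrable lborel (einterval a b) (\<lambda>y. y ^ (j + k) *\<^sub>R W y)"
      using weight unfolding matrix_weight_def by blast
    from integrable_bounded_linear[OF
        bounded_linear_compose[OF bounded_linear_mult_right bounded_linear_mult_left]
        this[unfolded set_integrable_def],
        of "pmat_coeff F j" "ctranspose (pmat_coeff G k)"]
    show ?thesis
      by (simp add: set_integrable_def linear_scale[OF bounded_linear.linear[OF bounded_linear_mult_left]]
        linear_scale[OF bounded_linear.linear[OF bounded_linear_mult_right]])
  qed
  ultimately show ?thesis
    unfolding set_integrable_def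
    by (simp only: scaleR_sum_right Bochner_Integration.integrable_sum)
qed

text \<open>\<open>W\<close> is Hermitian almost everywhere. All statements about the second argument are
  obtained from those about the first one by this symmetry.\<close>

lemma pairing_hermitian: "ctranspose (pairing F G) = pairing G F"
proof -
  have flip: "ctranspose (weight_integrand W (pmat_eval F) (pmat_eval G) y)
      = weight_integrand W (pmat_eval G) (pmat_eval F) y" if "ctranspose (W y) = W y" for y
    using that by (simp add: weight_integrand_def ctranspose_mult ctranspose_ctranspose matrix_mul_assoc)
  have "AE y in lborel. y \<in> einterval a b \<longrightarrow> ctranspose (W y) = W y"
    using weight unfolding matrix_weight_def positive_definite_def by (auto elim: eventually_mono)
  then have *: "AE y in lborel.
      ctranspose (indicator (einterval a b) y *\<^sub>R weight_integrand W (pmat_eval F) (pmat_eval G) y)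
      = indicator (einterval a b) y *\<^sub>R weight_integrand W (pmat_eval G) (pmat_eval F) y"
    by eventually_elim (auto simp: ctranspose_scaleR ctranspose_zero flip indicator_def)
  have "ctranspose (pairing F G) = (LINT y|lborel. ctranspose (indicator (einterval a b) y *\<^sub>R
      weight_integrand W (pmat_eval F) (pmat_eval G) y))"
    unfolding pairing_def weight_inner_def set_lebesgue_integral_def
    by (rule integral_bounded_linear[OF bounded_linear_ctranspose, symmetric])
       (use integrable_pairing in \<open>simp add: set_integrable_def\<close>)
  also have "\<dots> = pairing G F"
    unfolding pairing_def weight_inner_def set_lebesgue_integral_def
    using integrable_pairing[unfolded set_integrable_def]
    by (intro integral_cong_AE[OF _ _ *] borel_measurable_integrable
        integrable_bounded_linear[OF bounded_linear_ctranspose])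
  finally show ?thesis .
qed

lemma pairing_add_left: "pairing (F + F') G = pairing F G + pairing F' G"
proof -
  have "weight_integrand W (pmat_eval (F + F')) (pmat_eval G) y
      = weight_integrand W (pmat_eval F) (pmat_eval G) y
        + weight_integrand W (pmat_eval F') (pmat_eval G) y" for y
    by (simp add: weight_integrand_def pmat_eval_add matrix_mult_add_left)
  then show ?thesis
    by (simp add: pairing_def weight_inner_def set_integral_add(2)[OF integrable_pairing integrable_pairing])
qed

lemma pairing_const_left: "pairing (pmat_const X ** F) G = X ** pairing F G"
proof -
  have "pairing (pmat_const X ** F) G = (LINT y|lborel. X ** (indicator (einterval a b) y *\<^sub>R
      weight_integrand W (pmat_eval F) (pmat_eval G) y))"
    by (simp add: pairing_def weight_inner_def set_lebesgue_integral_def weight_integrand_def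
        pmat_eval_mult pmat_eval_const matrix_mul_assoc
        linear_scale[OF bounded_linear.linear[OF bounded_linear_mult_left]])
  also have "\<dots> = X ** pairing F G"
    unfolding pairing_def weight_inner_def set_lebesgue_integral_def
    by (rule integral_bounded_linear[OF bounded_linear_mult_left])
       (use integrable_pairing in \<open>simp add: set_integrable_def\<close>)
  finally show ?thesis .
qed

lemma pairing_add_right: "pairing F (G + G') = pairing F G + pairing F G'"
  by (metis pairing_hermitian pairing_add_left ctranspose_add)

lemma pairing_const_right: "pairing F (pmat_const X ** G) = pairing F G ** ctranspose X"
  by (metis pairing_hermitian pairing_const_left ctranspose_mult)

lemma pairing_zero_left: "pairing 0 G = 0"
  using pairing_add_left[of 0 0 G] by simp

lemma pairing_zero_right: "pairing F 0 = 0"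
  using pairing_add_right[of F 0 0] by simp

lemma pairing_diff_left: "pairing (F - F') G = pairing F G - pairing F' G"
  using pairing_add_left[of "F - F'" F' G] by simp

lemma pairing_diff_right: "pairing F (G - G') = pairing F G - pairing F G'"
  using pairing_add_right[of F "G - G'" G'] by simp

lemma pairing_sum_left: "pairing (sum f S) G = (\<Sum>s\<in>S. pairing (f s) G)"
  by (induction S rule: infinite_finite_induct) (auto simp: pairing_add_left pairing_zero_left)

text \<open>The variable \<open>x\<close> is real on the interval, and scalar matrices are central.\<close>

lemma pairing_x_mult: "pairing (mat [:0, 1:] ** F) G = pairing F (mat [:0, 1:] ** G)"
proof -
  have "weight_integrand W (pmat_eval (mat [:0, 1:] ** F)) (pmat_eval G)
      = weight_integrand W (pmat_eval F) (pmat_eval (mat [:0, 1:] ** G))"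
    using mat_mult_commute[of "of_real y" "pmat_eval F y ** W y ** ctranspose (pmat_eval G y)" for y]
    by (intro ext) (simp add: weight_integrand_def pmat_eval_mult pmat_eval_mat ctranspose_mult
        ctranspose_mat matrix_mul_assoc)
  then show ?thesis
    by (simp add: pairing_def weight_inner_def)
qed

end

section \<open>Integration by parts and orthogonality\<close>

text \<open>All that the string relations need from the weight and the operator, expressed
  through the pairing of polynomials; \<open>q\<close> stands for \<open>v'\<close>.\<close>

locale string_setting = weighted_interval a b W
  for a b :: ereal and W :: "real \<Rightarrow> 'n::finite cmat" +
  fixes P :: "nat \<Rightarrow> 'n pmat" and H B C :: "nat \<Rightarrow> 'n cmat"
    and A :: "'n cmat" and q :: "complex poly"
  assumes monic: "monic_pmat n (P n)"
    and norm_pos: "positive_definite (H n)"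
    and orthogonal: "pairing (P n) (P m) = (if n = m then H n else 0)"
    and recurrence: "three_term_recurrence P B C"
    and nabla_adjoint: "pairing (nabla A F) G = pairing F (mat q ** G - nabla A G)"
begin

lemma nabla_by_parts: "pairing (nabla A F) G + pairing F (nabla A G) = pairing F (mat q ** G)"
  by (simp add: nabla_adjoint pairing_diff_right)

text \<open>The left side of \<open>nabla_by_parts\<close> is invariant under exchanging \<open>F\<close> and \<open>G\<close> and
  taking the conjugate transpose, hence the right side is too. For a complex polynomial \<open>q\<close>
  this symmetry is not automatic: in the second argument, \<open>q\<close> enters the integral conjugated.\<close>

lemma potential_symmetric: "pairing F (mat q ** G) = pairing (mat q ** F) G"
proof -
  have "pairing (mat q ** F) G = ctranspose (pairing G (mat q ** F))"
    by (simp add: pairing_hermitian)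
  also have "\<dots> = pairing (nabla A F) G + pairing F (nabla A G)"
    by (simp add: nabla_by_parts[symmetric] ctranspose_add pairing_hermitian)
  finally show ?thesis
    by (simp add: nabla_by_parts)
qed

text \<open>Descent on the degree: subtracting the multiple of \<open>P d\<close> with the same leading
  coefficient lowers the degree and does not affect the pairing with \<open>P n\<close>.\<close>

lemma pairing_low_degree:
  assumes "\<And>k. k \<ge> d \<Longrightarrow> pmat_coeff F k = 0" and "n \<ge> d"
  shows "pairing F (P n) = 0"
  using assms
proof (induction d arbitrary: F)
  case 0
  then have "F = 0"
    by (intro pmat_eqI) (simp add: pmat_coeff_def vec_eq_iff)
  then show ?case
    by (simp add: pairing_zero_left)
next
  case (Suc d)
  let ?G = "F - pmat_const (pmat_coeff F d) ** P d"
  have "pmat_coeff ?G k = 0" if "k \<ge> d" for k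
    using monic[of d] Suc.prems(1)[of k] that
    by (cases "k = d") (auto simp: monic_pmat_def pmat_coeff_diff pmat_coeff_const_mult
        matrix_mult_zero_right)
  then have "pairing ?G (P n) = 0"
    using Suc by simp
  then show ?case
    using Suc.prems(2)
    by (simp add: pairing_diff_left pairing_const_left orthogonal matrix_mult_zero_right)
qed

text \<open>Pairing with \<open>P n\<close> reads off the leading coefficient, since the remainder has
  degree below \<open>n\<close>.\<close>

lemma pairing_top_degree:
  assumes "\<And>k. k > n \<Longrightarrow> pmat_coeff F k = 0"
  shows "pairing F (P n) = pmat_coeff F n ** H n"
proof -
  let ?G = "F - pmat_const (pmat_coeff F n) ** P n"
  have "pmat_coeff ?G k = 0" if "k \<ge> n" for k
    using monic[of n] assms[of k] that
    by (cases "k = n") (auto simp: monic_pmat_def pmat_coeff_diff pmat_coeff_const_mult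
        matrix_mult_zero_right)
  then have "pairing ?G (P n) = 0"
    by (intro pairing_low_degree[of n]) simp_all
  then show ?thesis
    by (simp add: pairing_diff_left pairing_const_left orthogonal)
qed

lemma
  shows nabla_P_lead: "pmat_coeff (nabla A (P n)) n = A"
    and nabla_P_degree: "k > n \<Longrightarrow> pmat_coeff (nabla A (P n)) k = 0"
  using monic[of n] by (auto simp: monic_pmat_def nabla_coeff matrix_mult_zero_left)

lemma pairing_nabla_above: "m > n \<Longrightarrow> pairing (nabla A (P n)) (P m) = 0"
  by (rule pairing_low_degree[of m]) (simp_all add: nabla_P_degree)

lemma pairing_nabla_diag: "pairing (nabla A (P n)) (P n) = A ** H n"
  by (simp add: pairing_top_degree nabla_P_lead nabla_P_degree)

section \<open>Recurrence coefficients and the operator q(L)\<close>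

abbreviation "V \<equiv> shiftop_poly q (jacobi_op B C)"

lemma C_0: "C 0 = 0"
  using recurrence by (simp add: three_term_recurrence_def)

lemma x_mult_P:
  "mat [:0, 1:] ** P n
   = P (n + 1) + pmat_const (B n) ** P n + pmat_const (C n) ** seq_at P (int n - 1)"
  using recurrence by (simp add: three_term_recurrence_def)

lemma norm_hermitian: "ctranspose (H n) = H n"
  using norm_pos[of n] by (simp add: positive_definite_def)

text \<open>The coefficient \<open>C\<close> is a quotient of consecutive norms: evaluate
  \<open>\<langle>x P(n), P(n+1)\<rangle>\<close> with \<open>x\<close> in either argument.\<close>

lemma norm_C: "C (Suc n) ** H n = H (Suc n)" and norm_C_adjoint: "H n ** ctranspose (C (Suc n)) = H (Suc n)"
proof -
  have "H n ** ctranspose (C (Suc n)) = pairing (P n) (mat [:0, 1:] ** P (Suc n))"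
    by (simp add: x_mult_P pairing_add_right pairing_const_right orthogonal seq_at_def
        matrix_mult_zero_left)
  also have "\<dots> = pairing (mat [:0, 1:] ** P n) (P (Suc n))"
    by (simp add: pairing_x_mult)
  also have "\<dots> = H (Suc n)"
    by (simp add: x_mult_P pairing_add_left pairing_const_left orthogonal seq_at_def
        matrix_mult_zero_right pairing_zero_left)
  finally show "H n ** ctranspose (C (Suc n)) = H (Suc n)" .
  then show "C (Suc n) ** H n = H (Suc n)"
    by (metis ctranspose_mult ctranspose_ctranspose norm_hermitian)
qed

lemma norm_B: "H n ** ctranspose (B n) = B n ** H n"
proof -
  have off: "pairing (seq_at P (int n - 1)) (P n) = 0" "pairing (P n) (seq_at P (int n - 1)) = 0"
    by (auto simp: seq_at_def pairing_zero_left pairing_zero_right orthogonal)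
  have "H n ** ctranspose (B n) = pairing (P n) (mat [:0, 1:] ** P n)"
    by (simp add: x_mult_P pairing_add_right pairing_const_right orthogonal off
        matrix_mult_zero_left)
  also have "\<dots> = pairing (mat [:0, 1:] ** P n) (P n)"
    by (simp add: pairing_x_mult)
  also have "\<dots> = B n ** H n"
    by (simp add: x_mult_P pairing_add_left pairing_const_left orthogonal off
        matrix_mult_zero_right)
  finally show ?thesis .
qed

text \<open>The support of \<open>L\<close> may be smaller than \<open>{-1, 0, 1}\<close>, but the missing terms are zero.\<close>

lemma shiftop_comp_jacobi:
  "shiftop_comp (jacobi_op B C) K j n =
     K (j - 1) (n + 1) + B n ** K j n + C n ** seq_at (K (j + 1)) (int n - 1)"
proof -
  have "shiftop_comp (jacobi_op B C) K j n
      = (\<Sum>i\<in>{1, 0, -1}. jacobi_op B C i n ** seq_at (K (j - i)) (int n + i))"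
    unfolding shiftop_comp_def
    by (rule sum.mono_neutral_left)
       (auto simp: shiftop_support_def jacobi_op_def matrix_mult_zero_left split: if_splits)
  then show ?thesis
    by (simp add: jacobi_op_def seq_at_def nat_add_distrib)
qed

text \<open>Multiplication by \<open>x\<close> acts as \<open>L\<close> on the sequence \<open>P\<close>, so multiplication by \<open>x\<^sup>r\<close> acts as
  \<open>L\<^sup>r\<close>; the pairing with \<open>P m\<close> extracts the coefficient of \<open>P m\<close>. In the induction the new factor
  \<open>x\<close> is applied to \<open>P n\<close> first, which matches \<open>L\<^sup>r\<^sup>+\<^sup>1\<close> being defined as \<open>L\<close> composed with \<open>L\<^sup>r\<close>.\<close>

lemma pairing_monom_mult:
  "pairing (mat (monom 1 r) ** P n) (P m) = shiftop_power (jacobi_op B C) r (int m - int n) n ** H m"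
proof (induction r arbitrary: n)
  case 0
  then show ?case
    by (auto simp: shiftop_power_def shiftop_id_def orthogonal matrix_mult_zero_left
        simp flip: one_pCons)
next
  case (Suc r)
  let ?K = "shiftop_power (jacobi_op B C) r"
  have mul: "mat p ** (mat p' ** F) = mat (p * p') ** F" for p p' :: "complex poly" and F :: "'n pmat"
    by (simp add: mat_mult_eq_scale vec_eq_iff mult.assoc)
  have "monom 1 (Suc r) = monom 1 r * [:0, 1 :: complex:]"
    by (simp add: monom_Suc)
  then have "mat (monom 1 (Suc r)) ** P n = mat (monom 1 r) ** (mat [:0, 1:] ** P n)"
    by (simp only: mul)
  also have "\<dots> = mat (monom 1 r) ** P (n + 1) + pmat_const (B n) ** (mat (monom 1 r) ** P n)
      + pmat_const (C n) ** (mat (monom 1 r) ** seq_at P (int n - 1))"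
    by (simp only: x_mult_P matrix_add_ldistrib matrix_mul_assoc
        mat_mult_commute[of _ "pmat_const (B n)"] mat_mult_commute[of _ "pmat_const (C n)"])
  finally have "pairing (mat (monom 1 (Suc r)) ** P n) (P m)
      = ?K (int m - int n - 1) (n + 1) ** H m + B n ** (?K (int m - int n) n ** H m)
      + C n ** pairing (mat (monom 1 r) ** seq_at P (int n - 1)) (P m)"
    using Suc[of n] Suc[of "n + 1"]
    by (simp add: pairing_add_left pairing_const_left algebra_simps)
  also have "pairing (mat (monom 1 r) ** seq_at P (int n - 1)) (P m)
      = seq_at (?K (int m - int n + 1)) (int n - 1) ** H m"
  proof (cases n)
    case 0
    then show ?thesis by (simp add: seq_at_def matrix_algebra_simps pairing_zero_left)
  next
    case (Suc n')
    then show ?thesis using Suc.IH[of n'] by (simp add: seq_at_def algebra_simps)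
  qed
  finally show ?case
    by (simp add: shiftop_power_def shiftop_comp_jacobi matrix_algebra_simps)
qed

lemma pairing_potential: "pairing (mat q ** P n) (P m) = V (int m - int n) n ** H m"
proof -
  have "mat q ** P n = (\<Sum>r\<le>degree q. pmat_const (mat (coeff q r)) ** (mat (monom 1 r) ** P n))"
  proof -
    have const: "pmat_const (mat c) = mat [:c:]" for c
      by (simp add: pmat_const_def vec_eq_iff mat_def)
    have "q * p = (\<Sum>r\<le>degree q. [:coeff q r:] * (monom 1 r * p))" for p
    proof -
      have "q * p = (\<Sum>r\<le>degree q. monom (coeff q r) r) * p"
        by (simp add: poly_as_sum_of_monoms)
      also have "\<dots> = (\<Sum>r\<le>degree q. [:coeff q r:] * (monom 1 r * p))"
        unfolding sum_distrib_right
      proof (rule sum.cong)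
        fix r
        have "monom (coeff q r) r = [:coeff q r:] * monom 1 r"
          by (simp add: smult_monom)
        then show "monom (coeff q r) r * p = [:coeff q r:] * (monom 1 r * p)"
          by (simp only: mult.assoc)
      qed simp
      finally show ?thesis .
    qed
    then show ?thesis
      unfolding const mat_mult_eq_scale by (simp only: vec_eq_iff nth_map_matrix sum_component simp_thms)
  qed
  then show ?thesis
    by (simp add: pairing_sum_left pairing_const_left pairing_monom_mult shiftop_poly_def
        matrix_mult_sum_left flip: matrix_mul_assoc)
qed

section \<open>The string relations\<close>

text \<open>Integration by parts for \<open>P n\<close> with itself; the two terms are conjugate
  transposes of each other.\<close>

lemma V_diag: "V 0 n ** H n = A ** H n + H n ** ctranspose A"
proof -
  have "V 0 n ** H n = pairing (nabla A (P n)) (P n) + pairing (P n) (nabla A (P n))"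
    using pairing_potential[of n n] by (simp add: nabla_by_parts potential_symmetric)
  also have "pairing (P n) (nabla A (P n)) = ctranspose (pairing (nabla A (P n)) (P n))"
    by (simp add: pairing_hermitian)
  finally show ?thesis
    by (simp add: pairing_nabla_diag ctranspose_mult norm_hermitian)
qed

text \<open>Integration by parts for \<open>P(n+1)\<close> with \<open>P(n)\<close>: the second term drops out because
  \<open>\<nabla>P(n)\<close> has degree at most \<open>n\<close>.\<close>

lemma pairing_nabla_sub: "pairing (nabla A (P (Suc n))) (P n) = V (-1) (Suc n) ** H n"
proof -
  have "pairing (P (Suc n)) (nabla A (P n)) = 0"
    using pairing_nabla_above[of n "Suc n"] pairing_hermitian[of "nabla A (P n)" "P (Suc n)"]
    by (simp add: ctranspose_zero)
  then show ?thesis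
    using nabla_by_parts[of "P (Suc n)" "P n"] pairing_potential[of "Suc n" n]
    by (simp add: potential_symmetric)
qed

text \<open>Powers of \<open>L\<close> never reach a negative index; this settles the case \<open>n = 0\<close> of the
  relation for \<open>B\<close>, where \<open>V\<^sub>-\<^sub>1(0)\<close> occurs.\<close>

lemma shiftop_power_jacobi_below: "int n + j < 0 \<Longrightarrow> shiftop_power (jacobi_op B C) r j n = 0"
proof (induction r arbitrary: n j)
  case 0
  then show ?case by (simp add: shiftop_power_def shiftop_id_def)
next
  case (Suc r)
  then have "seq_at (shiftop_power (jacobi_op B C) r (j + 1)) (int n - 1) = 0"
    by (simp add: seq_at_def)
  with Suc show ?case
    by (simp add: shiftop_power_def shiftop_comp_jacobi matrix_mult_zero_right)
qed

lemma V_below: "V (-1) 0 = 0"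
  by (simp add: shiftop_poly_def shiftop_power_jacobi_below matrix_mult_zero_right)

text \<open>Both evaluations of \<open>?E = \<langle>\<nabla>(x P(n)), P(n)\<rangle>\<close> use the three-term recurrence: the first
  one in the first argument, the second one, after the commutation relation, in the second
  argument. The adjoint coefficients produced there are turned back by \<open>H B\<^sup>* = B H\<close> and
  \<open>H(n-1) C(n)\<^sup>* = H(n)\<close>.\<close>

lemma string_relation_B: "commutator (B n) A = mat 1 + V (-1) n - V (-1) (n + 1)"
proof -
  let ?E = "pairing (nabla A (mat [:0, 1:] ** P n)) (P n)"
  \<comment> \<open>For \<open>n = 0\<close> the term vanishes by \<open>C 0 = 0\<close>, otherwise because the degree is below \<open>n\<close>.\<close>
  have low: "C n ** pairing (nabla A (seq_at P (int n - 1))) (P n) = 0"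
    by (cases n) (simp_all add: C_0 seq_at_def pairing_nabla_above matrix_mult_zero_left
        matrix_mult_zero_right)
  have "?E = V (-1) (Suc n) ** H n + B n ** A ** H n"
    by (simp add: x_mult_P nabla_add nabla_const_mult pairing_add_left pairing_const_left low
        pairing_nabla_sub pairing_nabla_diag matrix_mul_assoc)
  moreover have "?E = V (-1) n ** H n + A ** B n ** H n + H n"
  proof -
    have "?E = pairing (nabla A (P n)) (mat [:0, 1:] ** P n) + H n"
      by (simp add: nabla_x_mult pairing_add_left pairing_x_mult orthogonal)
    also have "pairing (nabla A (P n)) (mat [:0, 1:] ** P n)
        = A ** (H n ** ctranspose (B n))
          + pairing (nabla A (P n)) (seq_at P (int n - 1)) ** ctranspose (C n)"
      by (simp add: x_mult_P pairing_add_right pairing_const_right pairing_nabla_above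
          pairing_nabla_diag matrix_mul_assoc)
    also have "pairing (nabla A (P n)) (seq_at P (int n - 1)) ** ctranspose (C n) = V (-1) n ** H n"
    proof (cases n)
      case 0
      then show ?thesis
        by (simp add: V_below C_0 ctranspose_zero matrix_algebra_simps)
    next
      case (Suc m)
      then show ?thesis
        by (simp add: seq_at_def pairing_nabla_sub norm_C_adjoint flip: matrix_mul_assoc)
    qed
    finally show ?thesis
      by (simp add: norm_B matrix_mul_assoc)
  qed
  ultimately have "commutator (B n) A ** H n = (mat 1 + V (-1) n - V (-1) (n + 1)) ** H n"
    by (simp add: commutator_def matrix_algebra_simps algebra_simps)
  then show ?thesis
    by (rule positive_definite_right_cancel[OF norm_pos])
qed

text \<open>By \<open>V_diag\<close> at \<open>n\<close> and \<open>n + 1\<close>, each of the two products on the right,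
  multiplied by \<open>H(n)\<close>, contributes \<open>H(n+1) A\<^sup>*\<close>, and these terms cancel.\<close>

lemma string_relation_C:
  "commutator (C (Suc n)) A = C (Suc n) ** V 0 n - V 0 (Suc n) ** C (Suc n)"
proof -
  let ?C = "C (Suc n)"
  have "(?C ** V 0 n - V 0 (Suc n) ** ?C) ** H n
      = ?C ** (V 0 n ** H n) - V 0 (Suc n) ** (?C ** H n)"
    by (simp add: matrix_algebra_simps)
  also have "\<dots> = ?C ** A ** H n + (?C ** H n) ** ctranspose A
      - (A ** H (Suc n) + H (Suc n) ** ctranspose A)"
    by (simp only: V_diag norm_C matrix_add_ldistrib matrix_mul_assoc)
  also have "\<dots> = ?C ** A ** H n - A ** (?C ** H n)"
    by (simp add: norm_C)
  also have "\<dots> = commutator ?C A ** H n"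
    by (simp add: commutator_def matrix_algebra_simps)
  finally show ?thesis
    using positive_definite_right_cancel[OF norm_pos[of n]] by metis
qed

end

theorem theorem3p6:
  fixes a b :: ereal
    and W :: "real \<Rightarrow> complex^'n::finite^'n"
    and P :: "nat \<Rightarrow> complex poly^'n^'n"
    and A :: "complex^'n^'n"
    and v :: "complex poly"
    and k :: nat
    and D :: "'n diffop"
    and B C :: "nat \<Rightarrow> complex^'n^'n"
  assumes "matrix_weight a b W"
    and "monic_mvops a b W P"
    and "degree v = k"
    and "D = [:rmat_const A, mat 1:]"
    and "D \<in> fourier_right P"
    and "is_adjoint a b W D (- D + [:mat (to_fract (pderiv v)):])"
    and "three_term_recurrence P B C"
  shows "(\<forall>n\<ge>0. commutator (B n) A =
           mat 1 + shiftop_poly (pderiv v) (jacobi_op B C) (-1) n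
                 - shiftop_poly (pderiv v) (jacobi_op B C) (-1) (n + 1)) \<and>
         (\<forall>n\<ge>1. commutator (C n) A =
           C n ** shiftop_poly (pderiv v) (jacobi_op B C) 0 (n - 1)
           - shiftop_poly (pderiv v) (jacobi_op B C) 0 n ** C n)"
proof -
  interpret weighted_interval a b W
    by unfold_locales (rule assms(1))
  obtain H where "\<And>n. positive_definite (H n)"
    and "\<And>n m. weight_inner a b W (pmat_eval (P n)) (pmat_eval (P m)) = (if n = m then H n else 0)"
    and "\<And>n. monic_pmat n (P n)"
    using assms(2) unfolding monic_mvops_def by blast
  moreover have "pairing (nabla A F) G = pairing F (mat (pderiv v) ** G - nabla A G)" for F G
    using assms(6) unfolding is_adjoint_def assms(4) diffop_act_nabla diffop_act_nabla_adjoint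
      rmat_eval_of_pmat pairing_def by blast
  ultimately interpret string_setting a b W P H B C A "pderiv v"
    using assms(7) by unfold_locales (simp_all add: pairing_def)
  show ?thesis
  proof (intro conjI allI impI)
    fix n :: nat
    assume "n \<ge> 1"
    then obtain m where "n = Suc m"
      by (cases n) auto
    then show "commutator (C n) A = C n ** V 0 (n - 1) - V 0 n ** C n"
      by (simp add: string_relation_C)
  qed (rule string_relation_B)
qed

end
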